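(* The completed Witt Lie algebra $\widehat{\mathcal{L}}$ is simple.
   Context: The completed Witt Lie algebra $\widehat{\mathcal{L}}$ is the complex vector space of all formal infinite sums $\sum_{i=-1}^{\infty}a_iL_i$ with $a_i\in\mathbb{C}$ (where $L_i$, $i\ge-1$, are symbols and two sums are equal iff all their coefficients agree), with Lie bracket $$\Big[\sum_{i=-1}^{\infty}a_iL_i,\sum_{i=-1}^{\infty}b_iL_i\Big]=\sum_{i=-1}^{\infty}\Big(\sum_{j=-1}^{i+1}(2j-i)a_{i-j}b_j\Big)L_i,$$ so that $[L_i,L_j]=(j-i)L_{i+j}$. Realizing $L_i$ as $t^{i+1}\frac{d}{dt}$, one has $\widehat{\mathcal{L}}=\mathbb{C}[[t]]\frac{d}{dt}$. *)

theory Defs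
  imports Complex_Main
begin

locale lie_algebra = vector_space scale
  for scale :: "'k::field \<Rightarrow> 'v::ab_group_add \<Rightarrow> 'v" +
  fixes bracket :: "'v \<Rightarrow> 'v \<Rightarrow> 'v"
  assumes bracket_linear_left: "Vector_Spaces.linear scale scale (\<lambda>x. bracket x y)"
    and bracket_linear_right: "Vector_Spaces.linear scale scale (\<lambda>y. bracket x y)"
    and bracket_self: "bracket x x = 0"
    and jacobi: "bracket x (bracket y z) + bracket y (bracket z x) + bracket z (bracket x y) = 0"
begin

definition lie_ideal :: "'v set \<Rightarrow> bool" where
  "lie_ideal I \<longleftrightarrow> subspace I \<and> (\<forall>x. \<forall>y\<in>I. bracket x y \<in> I)"

definition abelian :: bool where
  "abelian \<longleftrightarrow> (\<forall>x y. bracket x y = 0)"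

end

locale simple_lie_algebra = lie_algebra scale bracket
  for scale :: "'k::field \<Rightarrow> 'v::ab_group_add \<Rightarrow> 'v"
    and bracket :: "'v \<Rightarrow> 'v \<Rightarrow> 'v" +
  assumes not_abelian: "\<not> abelian"
    and ideal_trivial: "lie_ideal I \<Longrightarrow> I = {0} \<or> I = UNIV"

text \<open>
  The formal sum \<open>\<Sum>i\<ge>-1. a i L\<^sub>i\<close> is represented by its family of coefficients, extended by
  \<open>0\<close> to the indices below \<open>-1\<close>.
\<close>

typedef completed_witt = "{a :: int \<Rightarrow> complex. \<forall>i < -1. a i = 0}"
  morphisms witt_coeff Abs_completed_witt
  by (rule exI[of _ "\<lambda>_. 0"]) simp

setup_lifting type_definition_completed_witt

lemma witt_coeff_below: "i < -1 \<Longrightarrow> witt_coeff x i = 0"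
  by transfer simp

lemma completed_witt_eqI:
  assumes "\<And>i. i \<ge> -1 \<Longrightarrow> witt_coeff x i = witt_coeff y i"
  shows "x = y"
proof -
  have "witt_coeff x i = witt_coeff y i" for i
    using assms[of i] witt_coeff_below[of i] by (cases "i < -1") auto
  then show ?thesis
    by (simp add: witt_coeff_inject[symmetric] fun_eq_iff)
qed

instantiation completed_witt :: ab_group_add
begin

lift_definition zero_completed_witt :: completed_witt is "\<lambda>_. 0" by simp

lift_definition plus_completed_witt :: "completed_witt \<Rightarrow> completed_witt \<Rightarrow> completed_witt"
  is "\<lambda>a b i. a i + b i" by simp

lift_definition minus_completed_witt :: "completed_witt \<Rightarrow> completed_witt \<Rightarrow> completed_witt"
  is "\<lambda>a b i. a i - b i" by simp

lift_definition uminus_completed_witt :: "completed_witt \<Rightarrow> completed_witt"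
  is "\<lambda>a i. - a i" by simp

instance
  by standard (transfer; simp add: fun_eq_iff algebra_simps)+

end

lift_definition witt_scale :: "complex \<Rightarrow> completed_witt \<Rightarrow> completed_witt"
  is "\<lambda>c a i. c * a i" by simp

text \<open>
  No case distinction on \<open>i \<ge> -1\<close> is needed: the sum is empty for \<open>i < -2\<close>, and for \<open>i = -2\<close>
  its only summand, at \<open>j = -1\<close>, carries the factor \<open>2 * j - i = 0\<close>.
\<close>

lift_definition witt_bracket :: "completed_witt \<Rightarrow> completed_witt \<Rightarrow> completed_witt"
  is "\<lambda>a b i. \<Sum>j = -1..i + 1. of_int (2 * j - i) * a (i - j) * b j"
proof -
  fix a b :: "int \<Rightarrow> complex" and i :: int
  assume i: "i < -1"
  show "(\<Sum>j = -1..i + 1. of_int (2 * j - i) * a (i - j) * b j) = 0"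
  proof (rule sum.neutral, intro ballI)
    fix j assume "j \<in> {-1..i + 1}"
    with i have "2 * j - i = 0" by auto
    then show "of_int (2 * j - i) * a (i - j) * b j = 0" by (simp only: of_int_0 mult_zero_left)
  qed
qed

lift_definition witt_L :: "int \<Rightarrow> completed_witt"
  is "\<lambda>i k. if k = i \<and> i \<ge> -1 then 1 else 0" by simp

lemma witt_bracket_L:
  assumes "i \<ge> -1" "j \<ge> -1"
  shows "witt_bracket (witt_L i) (witt_L j) = witt_scale (of_int (j - i)) (witt_L (i + j))"
proof (rule completed_witt_eqI)
  fix k :: int
  assume "k \<ge> -1"
  have "witt_coeff (witt_bracket (witt_L i) (witt_L j)) k
      = (\<Sum>l = -1..k + 1. if l = j then (if k = i + j then of_int (j - i) else 0) else 0)"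
    unfolding witt_bracket.rep_eq witt_L.rep_eq
    by (rule sum.cong) (use assms in auto)
  also have "\<dots> = (if k = i + j then of_int (j - i) else 0)"
    using assms by (subst sum.delta) auto
  also have "\<dots> = witt_coeff (witt_scale (of_int (j - i)) (witt_L (i + j))) k"
    using \<open>k \<ge> -1\<close> by (auto simp: witt_scale.rep_eq witt_L.rep_eq)
  finally show "witt_coeff (witt_bracket (witt_L i) (witt_L j)) k
      = witt_coeff (witt_scale (of_int (j - i)) (witt_L (i + j))) k" .
qed

end

theory Submission
  imports Defs "HOL-Computational_Algebra.Formal_Power_Series"
begin

text \<open>
  Read \<open>\<Sum>i a i L\<^sub>i\<close> as the vector field \<open>f d/dt\<close> with \<open>f = \<Sum>i a i t\<^bsup>i+1\<^esup>\<close>. The bracket of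
  \<open>f d/dt\<close> and \<open>g d/dt\<close> then has the Wronskian \<open>f * g' - g * f'\<close> as its coefficient series
  (\<open>witt_fps_bracket\<close>), and the Lie algebra axioms become identities between polynomials in
  power series and their derivatives.

  For simplicity, let \<open>I\<close> be a nonzero ideal. Bracketing with \<open>L\<^bsub>-1\<^esub> = d/dt\<close> differentiates the
  series; differentiating a nonzero element of \<open>I\<close> as often as its order of vanishing at \<open>0\<close>
  gives an \<open>f d/dt\<close> in \<open>I\<close> with \<open>f(0) \<noteq> 0\<close>. Such an \<open>f\<close> is a unit of the power
  series ring, and by the quotient rule the equation \<open>f * g' - g * f' = h\<close> says
  \<open>(g/f)' = h/f\<^sup>2\<close>. In characteristic \<open>0\<close> every power series has an antiderivative, so this can be
  solved for \<open>g\<close> whatever \<open>h\<close> is (\<open>fps_wronskian_surj\<close>). Hence \<open>ad (f d/dt)\<close> is already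
  surjective, and its image lies in \<open>I\<close>. Every vector field is thus reached by a single bracket
  with one element of \<open>I\<close>, rather than as an infinite sum of elements of \<open>I\<close>, under which an
  ideal might fail to be closed.
\<close>

definition witt_fps :: "completed_witt \<Rightarrow> complex fps" where
  "witt_fps x = Abs_fps (\<lambda>n. witt_coeff x (int n - 1))"

lift_definition fps_witt :: "complex fps \<Rightarrow> completed_witt"
  is "\<lambda>f i. if i < -1 then 0 else fps_nth f (nat (i + 1))" by simp

lemma witt_fps_nth: "fps_nth (witt_fps x) n = witt_coeff x (int n - 1)"
  by (simp add: witt_fps_def)

lemma witt_fps_fps_witt [simp]: "witt_fps (fps_witt f) = f"
  by (simp add: fps_eq_iff witt_fps_nth fps_witt.rep_eq)

lemma witt_fps_eq_iff: "witt_fps x = witt_fps y \<longleftrightarrow> x = y"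
proof
  assume eq: "witt_fps x = witt_fps y"
  show "x = y"
  proof (rule completed_witt_eqI)
    fix i :: int
    assume "i \<ge> -1"
    then show "witt_coeff x i = witt_coeff y i"
      using arg_cong[OF eq, of "\<lambda>f. fps_nth f (nat (i + 1))"] by (simp add: witt_fps_nth)
  qed
qed simp

lemma witt_fps_0: "witt_fps 0 = 0"
  by (simp add: fps_eq_iff witt_fps_nth zero_completed_witt.rep_eq)

lemma witt_fps_add: "witt_fps (x + y) = witt_fps x + witt_fps y"
  by (simp add: fps_eq_iff witt_fps_nth plus_completed_witt.rep_eq)

lemma witt_fps_scale: "witt_fps (witt_scale c x) = fps_const c * witt_fps x"
  by (simp add: fps_eq_iff witt_fps_nth witt_scale.rep_eq)

text \<open>
  Both products of the Wronskian are sums over the same pairs of coefficients: the \<open>k\<close>-th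
  coefficient of \<open>g\<close> meets the \<open>(n+1-k)\<close>-th of \<open>f\<close>, with weight \<open>k\<close> from \<open>f * g'\<close> and \<open>n+1-k\<close>
  from \<open>g * f'\<close>. With \<open>i = n - 1\<close> and \<open>j = k - 1\<close> the difference of the weights is \<open>2j - i\<close>.
\<close>

lemma witt_fps_bracket:
  "witt_fps (witt_bracket x y)
     = witt_fps x * fps_deriv (witt_fps y) - witt_fps y * fps_deriv (witt_fps x)"
proof (rule fps_ext)
  fix n :: nat
  define f g where "f = witt_fps x" and "g = witt_fps y"
  have fg': "fps_nth (f * fps_deriv g) n
      = (\<Sum>k\<le>Suc n. of_nat k * fps_nth f (Suc n - k) * fps_nth g k)"
    by (subst mult.commute[of f], unfold fps_mult_nth)
      (simp add: atLeast0AtMost sum.atMost_Suc_shift mult_ac del: sum.atMost_Suc of_nat_Suc)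
  have gf': "fps_nth (g * fps_deriv f) n
      = (\<Sum>k\<le>Suc n. of_nat (Suc n - k) * fps_nth f (Suc n - k) * fps_nth g k)"
    by (auto simp: fps_mult_nth atLeast0AtMost Suc_diff_le mult_ac intro!: sum.cong)
  have "fps_nth (witt_fps (witt_bracket x y)) n
      = (\<Sum>j = -1..int n. of_int (2 * j - (int n - 1)) * witt_coeff x (int n - 1 - j)
          * witt_coeff y j)"
    by (simp add: witt_fps_nth witt_bracket.rep_eq)
  also have "\<dots> = (\<Sum>k\<le>Suc n. (of_nat k - of_nat (Suc n - k)) * fps_nth f (Suc n - k)
      * fps_nth g k)"
    by (rule sum.reindex_bij_witness[where i = "\<lambda>k. int k - 1" and j = "\<lambda>j. nat (j + 1)"])
      (auto simp: f_def g_def witt_fps_nth of_nat_diff algebra_simps)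
  also have "\<dots> = fps_nth (f * fps_deriv g - g * fps_deriv f) n"
    unfolding fps_sub_nth fg' gf' by (simp only: sum_subtractf[symmetric] left_diff_distrib)
  finally show "fps_nth (witt_fps (witt_bracket x y)) n
      = fps_nth (witt_fps x * fps_deriv (witt_fps y) - witt_fps y * fps_deriv (witt_fps x)) n"
    by (simp only: f_def g_def)
qed

lemma vector_space_witt: "vector_space witt_scale"
  unfolding vector_space_def
  by (simp add: witt_fps_eq_iff[symmetric] witt_fps_add witt_fps_scale distrib_left distrib_right
      mult.assoc flip: fps_const_add fps_const_mult)

lemma lie_algebra_witt: "lie_algebra witt_scale witt_bracket"
proof (intro lie_algebra.intro lie_algebra_axioms.intro vector_space_witt)
  show "Vector_Spaces.linear witt_scale witt_scale (\<lambda>x. witt_bracket x y)" for y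
    by (simp add: Vector_Spaces.linear_iff vector_space_witt witt_fps_eq_iff[symmetric]
        witt_fps_add witt_fps_scale witt_fps_bracket algebra_simps)
  show "Vector_Spaces.linear witt_scale witt_scale (\<lambda>y. witt_bracket x y)" for x
    by (simp add: Vector_Spaces.linear_iff vector_space_witt witt_fps_eq_iff[symmetric]
        witt_fps_add witt_fps_scale witt_fps_bracket algebra_simps)
  show "witt_bracket x x = 0" for x
    by (simp add: witt_fps_eq_iff[symmetric] witt_fps_bracket witt_fps_0)
  show "witt_bracket x (witt_bracket y z) + witt_bracket y (witt_bracket z x)
      + witt_bracket z (witt_bracket x y) = 0" for x y z
    by (simp add: witt_fps_eq_iff[symmetric] witt_fps_bracket witt_fps_add witt_fps_0
        algebra_simps)
qed

text \<open>
  The solution \<open>g = f * \<integral> h/f\<^sup>2\<close> comes from variation of constants: \<open>g = f\<close> solves the homogeneous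
  equation.
\<close>

lemma fps_wronskian_surj:
  fixes f h :: "'a::field_char_0 fps"
  assumes "fps_nth f 0 \<noteq> 0"
  obtains g where "f * fps_deriv g - g * fps_deriv f = h"
proof
  define q where "q = fps_integral0 (h * inverse (f\<^sup>2))"
  have "f * fps_deriv (f * q) - f * q * fps_deriv f = f\<^sup>2 * fps_deriv q"
    by (simp add: power2_eq_square algebra_simps)
  also have "\<dots> = h * (inverse (f\<^sup>2) * f\<^sup>2)"
    by (simp add: q_def fps_deriv_fps_integral mult_ac)
  also have "inverse (f\<^sup>2) * f\<^sup>2 = 1"
    using assms by (intro inverse_mult_eq_1) (simp add: fps_nth_power_0)
  finally show "f * fps_deriv (f * q) - f * q * fps_deriv f = h" by simp
qed

text \<open>
  The \<open>n\<close>-th derivative of \<open>f\<close> has constant term \<open>n!\<close> times the \<open>n\<close>-th coefficient of \<open>f\<close>, which is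
  nonzero in characteristic \<open>0\<close>.
\<close>

lemma fps_deriv_closed_imp_unit:
  fixes J :: "'a::field_char_0 fps set"
  assumes closed: "\<And>f. f \<in> J \<Longrightarrow> fps_deriv f \<in> J"
    and "f \<in> J" "fps_nth f n \<noteq> 0"
  obtains g where "g \<in> J" "fps_nth g 0 \<noteq> 0"
  using assms(2-3)
proof (induction n arbitrary: f thesis)
  case (Suc n)
  have "fps_nth (fps_deriv f) n \<noteq> 0"
    using Suc.prems(3) by (simp del: of_nat_Suc)
  with Suc.IH Suc.prems(1) closed[OF Suc.prems(2)] show ?case by blast
qed

theorem theorem2p4: "simple_lie_algebra witt_scale witt_bracket"
proof -
  interpret lie_algebra witt_scale witt_bracket by (rule lie_algebra_witt)
  show ?thesis
  proof
    (* [d/dt, t d/dt] = d/dt *)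
    have "witt_fps (witt_bracket (fps_witt 1) (fps_witt fps_X)) \<noteq> witt_fps 0"
      by (simp add: witt_fps_bracket witt_fps_0)
    then show "\<not> abelian"
      unfolding abelian_def by metis
  next
    fix I
    assume "lie_ideal I"
    then have "subspace I" and bracket_in: "\<And>x y. y \<in> I \<Longrightarrow> witt_bracket x y \<in> I"
      by (auto simp: lie_ideal_def)
    then have "0 \<in> I" by (simp add: subspace_0)
    show "I = {0} \<or> I = UNIV"
    proof (cases "I = {0}")
      case False
      with \<open>0 \<in> I\<close> obtain x where "x \<in> I" "x \<noteq> 0" by blast
      then obtain n where "fps_nth (witt_fps x) n \<noteq> 0"
        by (metis fps_nonzero_nth witt_fps_0 witt_fps_eq_iff)
      moreover have "fps_deriv f \<in> witt_fps ` I" if "f \<in> witt_fps ` I" for f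
      proof -
        from that obtain y where "y \<in> I" "f = witt_fps y" by blast
        (* the constant series 1 is L_{-1} = d/dt *)
        then have "fps_deriv f = witt_fps (witt_bracket (fps_witt 1) y)"
          by (simp add: witt_fps_bracket)
        with bracket_in[OF \<open>y \<in> I\<close>] show ?thesis by blast
      qed
      ultimately obtain y where "y \<in> I" and unit: "fps_nth (witt_fps y) 0 \<noteq> 0"
        using \<open>x \<in> I\<close> fps_deriv_closed_imp_unit[of "witt_fps ` I" "witt_fps x" n] by blast
      have "z \<in> I" for z
      proof -
        (* the ideal condition brackets from the left, hence the sign *)
        obtain g where
          g: "witt_fps y * fps_deriv g - g * fps_deriv (witt_fps y) = - witt_fps z"
          using fps_wronskian_surj[OF unit] .
        have "witt_fps (witt_bracket (fps_witt g) y)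
            = - (witt_fps y * fps_deriv g - g * fps_deriv (witt_fps y))"
          by (simp add: witt_fps_bracket)
        with g have "witt_bracket (fps_witt g) y = z"
          by (simp add: witt_fps_eq_iff)
        with bracket_in[OF \<open>y \<in> I\<close>] show ?thesis by blast
      qed
      then show ?thesis by blast
    qed simp
  qed
qed

end
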